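(* For any $r,d,q\in\mathbb{N}$ there exists $N=N(r,d,q)\in\mathbb{N}$ such that, with $V=\{1,\dots,N\}^d\times\{1,\dots,q\}$, the following holds: for any $r$-coloring of the set of all subsets of $V$ there exist a set $a\subseteq V$ and a nonempty set $\gamma\subseteq\{1,\dots,N\}$ such that $a\cap(\gamma^d\times\{1,\dots,q\})=\emptyset$ and the sets $$a,\quad a\cup(\gamma^d\times\{1\}),\quad a\cup(\gamma^d\times\{2\}),\quad\dots,\quad a\cup(\gamma^d\times\{q\})$$ all have the same color.
   Context: An $r$-coloring of a set $W$ is a map $\chi:W\to\{1,\dots,r\}$; elements have the same color if $\chi$ takes the same value on them. $\gamma^d$ denotes the $d$-fold Cartesian power of $\gamma$. *)

theory Defs
  imports Main "HOL-Library.FuncSet"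
begin

definition r_coloring :: "nat \<Rightarrow> 'a set \<Rightarrow> ('a \<Rightarrow> nat) \<Rightarrow> bool" where
  "r_coloring r W \<chi> \<longleftrightarrow> \<chi> \<in> W \<rightarrow> {1..r}"

(* A d-tuple is represented by an extensional function on the index set {1..d}. *)
definition cart_power :: "'a set \<Rightarrow> nat \<Rightarrow> (nat \<Rightarrow> 'a) set" where
  "cart_power \<gamma> d = {1..d} \<rightarrow>\<^sub>E \<gamma>"

end

theory Submission
  imports Defs "HOL-Library.Multiset"
begin

text \<open>
  Subsets of \<open>V\<close> are regarded as 0-1 configurations on cells, where the cell \<open>(t, i)\<close> is supported on
  the set of entries of the tuple \<open>t\<close>. Adding \<open>\<gamma>\<^sup>d \<times> {i}\<close> to \<open>a\<close> amounts to overwriting \<open>a\<close>, on the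
  cells supported inside \<open>\<gamma>\<close>, by a fixed configuration \<open>f\<^sub>i\<close>; not adding anything amounts to
  overwriting by the empty configuration. A finite family of configurations is measured from a base
  configuration \<open>p\<close>: the degree of \<open>f\<close> is the largest support size of a cell on which \<open>f\<close> and \<open>p\<close>
  differ, and configurations of the same degree are in one class if they differ only on cells of
  smaller support. The weight of the family is the multiset of the degrees of its classes.

  The proof is by induction on the weight (PET induction), with an inner colour focusing argument.
  To lengthen a focused sequence living on a finite set \<open>X\<close> of coordinates, one colours a
  configuration outside \<open>X\<close> by the entire colouring that it induces on the configurations inside \<open>X\<close>,
  and applies the induction hypothesis to the members of the family as seen from outside \<open>X\<close>, once
  for every \<open>\<delta> \<subseteq> X\<close>. Cells meeting both \<open>X\<close> and its complement have a smaller support outside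
  \<open>X\<close>, so taking a member of least degree as the new base lowers the weight.
\<close>

section \<open>Configurations, graded families and focusing\<close>

text \<open>Cells of empty support are left out on purpose: once \<open>X\<close> is removed from
  all supports, the cells living inside \<open>X\<close> have empty support and are no longer
  touched by overwriting.\<close>

definition cells_in :: "('w \<Rightarrow> 'u set) \<Rightarrow> 'u set \<Rightarrow> 'w set" where
  "cells_in supp X = {w. supp w \<noteq> {} \<and> supp w \<subseteq> X}"

definition overwrite :: "'w set \<Rightarrow> 'w set \<Rightarrow> 'w set \<Rightarrow> 'w set" where
  "overwrite a D f = (a - D) \<union> (f \<inter> D)"

definition agree_from :: "('w \<Rightarrow> 'u set) \<Rightarrow> nat \<Rightarrow> 'w set \<Rightarrow> 'w set \<Rightarrow> bool" where
  "agree_from supp e f g \<longleftrightarrow>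
    (\<forall>w. supp w \<noteq> {} \<longrightarrow> e \<le> card (supp w) \<longrightarrow> (w \<in> f \<longleftrightarrow> w \<in> g))"

definition members :: "(nat \<times> 'w set set) multiset \<Rightarrow> 'w set set" where
  "members L = (\<Union>(e, F)\<in>set_mset L. F)"

text \<open>The label \<open>e\<close> only bounds the degree from above, so exact degrees never
  have to be computed and a class may be split into singletons.\<close>

definition graded_family ::
    "('w \<Rightarrow> 'u set) \<Rightarrow> 'w set \<Rightarrow> (nat \<times> 'w set set) multiset \<Rightarrow> bool" where
  "graded_family supp p L \<longleftrightarrow>
    (\<forall>(e, F)\<in>set_mset L. finite F \<and>
      (\<forall>f\<in>F. agree_from supp (Suc e) p f \<and> (\<forall>g\<in>F. agree_from supp e f g)))"

definition locally_finite :: "('w \<Rightarrow> 'u set) \<Rightarrow> bool" where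
  "locally_finite supp \<longleftrightarrow>
    (\<forall>w. finite (supp w)) \<and> (\<forall>X. finite X \<longrightarrow> finite (cells_in supp X))"

definition monochromatic_in ::
    "('w \<Rightarrow> 'u set) \<Rightarrow> 'w set \<Rightarrow> 'w set set \<Rightarrow> 'u set \<Rightarrow> ('w set \<Rightarrow> nat) \<Rightarrow> bool" where
  "monochromatic_in supp p G X \<chi> \<longleftrightarrow>
    (\<exists>a \<gamma>. \<gamma> \<noteq> {} \<and> \<gamma> \<subseteq> X \<and>
      (\<forall>f\<in>G. \<chi> (overwrite a (cells_in supp \<gamma>) f) = \<chi> (overwrite a (cells_in supp \<gamma>) p)))"

text \<open>\<open>b\<close> is the common focus: it already carries \<open>p\<close> on each
  \<delta>. Indexing the sets \<delta> by their colours \<open>c\<close> builds in that the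
  \<open>m\<close> colours are distinct.\<close>

definition focused_in ::
    "('w \<Rightarrow> 'u set) \<Rightarrow> 'w set \<Rightarrow> 'w set set \<Rightarrow> 'u set \<Rightarrow> ('w set \<Rightarrow> nat) \<Rightarrow> nat \<Rightarrow> bool" where
  "focused_in supp p G X \<chi> m \<longleftrightarrow>
    (\<exists>b C. finite C \<and> card C = m \<and>
      (\<forall>c\<in>C. \<exists>\<delta>. \<delta> \<noteq> {} \<and> \<delta> \<subseteq> X \<and> overwrite b (cells_in supp \<delta>) p = b \<and>
        (\<forall>f\<in>G. \<chi> (overwrite b (cells_in supp \<delta>) f) = c)))"

text \<open>The configuration \<open>f\<close> written on \<open>\<delta> \<union> \<gamma>\<close> and \<open>p\<close> on the rest of \<open>X \<union> \<gamma>\<close>, for any \<open>\<gamma>\<close> disjoint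
  from \<open>X\<close>.\<close>

definition shift ::
    "('w \<Rightarrow> 'u set) \<Rightarrow> 'w set \<Rightarrow> 'u set \<Rightarrow> 'w set \<Rightarrow> 'u set \<Rightarrow> 'w set" where
  "shift supp p X f \<delta> = {w. if supp w \<inter> X \<subseteq> \<delta> then w \<in> f else w \<in> p}"

lemma members_add_mset [simp]: "members (add_mset (e, F) L) = F \<union> members L"
  by (auto simp: members_def)

section \<open>Degrees after removing coordinates\<close>

lemma locally_finite_diff:
  assumes "locally_finite supp" and "finite X"
  shows "locally_finite (\<lambda>w. supp w - X)"
proof -
  have "finite (cells_in (\<lambda>w. supp w - X) Y)" if "finite Y" for Y
  proof (rule finite_subset)
    show "cells_in (\<lambda>w. supp w - X) Y \<subseteq> cells_in supp (X \<union> Y)"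
      by (auto simp: cells_in_def)
    show "finite (cells_in supp (X \<union> Y))"
      using assms that by (simp add: locally_finite_def)
  qed
  then show ?thesis
    using assms by (simp add: locally_finite_def)
qed

text \<open>This is the source of the drop in degree. On a cell disjoint from \<open>X\<close> the
  support is unchanged and the shifts are \<open>f\<close> and \<open>g\<close> themselves. A cell
  meeting \<open>X\<close> loses a coordinate, so its support had size at least
  \<open>Suc e\<close>, where \<open>f\<close>, \<open>g\<close> and \<open>p\<close>
  coincide.\<close>

lemma agree_from_shift:
  assumes fin: "\<And>w. finite (supp w)"
    and pf: "agree_from supp (Suc e) p f" and pg: "agree_from supp (Suc e) p g"
    and fg: "agree_from supp e f g"
  shows "agree_from (\<lambda>w. supp w - X) e (shift supp p X f \<delta>) (shift supp p X g \<epsilon>)"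
  unfolding agree_from_def
proof (intro allI impI)
  fix w assume ne: "supp w - X \<noteq> {}" and e: "e \<le> card (supp w - X)"
  show "w \<in> shift supp p X f \<delta> \<longleftrightarrow> w \<in> shift supp p X g \<epsilon>"
  proof (cases "supp w \<inter> X = {}")
    case True
    then have "supp w - X = supp w" by blast
    then show ?thesis
      using fg ne e True by (simp add: agree_from_def shift_def)
  next
    case False
    then have "supp w - X \<subset> supp w" by blast
    then have "card (supp w - X) < card (supp w)"
      by (intro psubset_card_mono fin)
    with e ne have "supp w \<noteq> {}" "Suc e \<le> card (supp w)" by auto
    then show ?thesis
      using pf pg by (simp add: agree_from_def shift_def)
  qed
qed

text \<open>Serves the classes whose label is kept: shrinking supports cannot raise a
  degree.\<close>

lemma agree_from_shift_base:
  assumes fin: "\<And>w. finite (supp w)"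
    and pf: "agree_from supp k p f" and pg: "agree_from supp k p g"
  shows "agree_from (\<lambda>w. supp w - X) k (shift supp p X f \<delta>) (shift supp p X g \<epsilon>)"
  unfolding agree_from_def
proof (intro allI impI)
  fix w assume ne: "supp w - X \<noteq> {}" and k: "k \<le> card (supp w - X)"
  have "card (supp w - X) \<le> card (supp w)"
    by (intro card_mono fin) auto
  with ne k have "supp w \<noteq> {}" "k \<le> card (supp w)" by auto
  then show "w \<in> shift supp p X f \<delta> \<longleftrightarrow> w \<in> shift supp p X g \<epsilon>"
    using pf pg by (simp add: agree_from_def shift_def)
qed

lemma agree_from_mono: "agree_from supp k f g \<Longrightarrow> k \<le> l \<Longrightarrow> agree_from supp l f g"
  by (auto simp: agree_from_def)

section \<open>Overwriting and lengthening focused sequences\<close>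

lemma overwrite_agree_from_one:
  assumes fin: "\<And>w. finite (supp w)" and "agree_from supp 1 p f"
  shows "overwrite a (cells_in supp X) f = overwrite a (cells_in supp X) p"
proof -
  have "w \<in> p \<longleftrightarrow> w \<in> f" if "w \<in> cells_in supp X" for w
    using assms that by (simp add: agree_from_def cells_in_def Suc_le_eq card_gt_0_iff)
  then show ?thesis
    by (auto simp: overwrite_def)
qed

text \<open>Pasting \<open>z\<close> outside \<open>cells_in supp X\<close> commutes with
  overwriting inside \<open>X\<close>, so the pasted configuration is the witness.\<close>

lemma monochromatic_in_restrict:
  assumes "monochromatic_in supp p G X (\<lambda>x. \<chi> (x \<inter> cells_in supp X \<union> (z - cells_in supp X)))"
    and "X \<subseteq> Y"
  shows "monochromatic_in supp p G Y \<chi>"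
proof -
  let ?B = "cells_in supp X"
  obtain b \<delta> where \<delta>: "\<delta> \<noteq> {}" "\<delta> \<subseteq> X" and
    mono: "\<forall>f\<in>G. \<chi> (overwrite b (cells_in supp \<delta>) f \<inter> ?B \<union> (z - ?B))
      = \<chi> (overwrite b (cells_in supp \<delta>) p \<inter> ?B \<union> (z - ?B))"
    using assms(1) by (auto simp: monochromatic_in_def)
  have "cells_in supp \<delta> \<subseteq> ?B"
    using \<delta> by (auto simp: cells_in_def)
  then have "overwrite b (cells_in supp \<delta>) f \<inter> ?B \<union> (z - ?B)
      = overwrite (b \<inter> ?B \<union> (z - ?B)) (cells_in supp \<delta>) f" for f
    by (auto simp: overwrite_def)
  then show ?thesis
    using mono \<delta> assms(2) unfolding monochromatic_in_def by (metis order_trans)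
qed

lemma monochromatic_if_focus_coloured:
  assumes "\<delta> \<noteq> {}" "\<delta> \<subseteq> X" "overwrite b (cells_in supp \<delta>) p = b"
    and "\<forall>f\<in>G. \<chi> (overwrite b (cells_in supp \<delta>) f) = \<chi> b"
  shows "monochromatic_in supp p G X \<chi>"
  unfolding monochromatic_in_def using assms by metis

text \<open>This explains the form of \<open>shift\<close>. A cell outside \<open>B X\<close> is
  overwritten on the left exactly if its part off \<open>X\<close> is nonempty and inside \<gamma>
  and its part in \<open>X\<close> lies in \<delta>. Where only the condition on \<gamma> holds, the
  right side writes \<open>p\<close>, which the left side already carries.\<close>

lemma overwrite_union_shift:
  fixes supp :: "'w \<Rightarrow> 'u set"
  defines "B X \<equiv> cells_in supp X"
  assumes "\<gamma> \<inter> X = {}" and "\<delta> \<subseteq> X"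
  shows "overwrite (b \<inter> B X \<union> (overwrite a (cells_in (\<lambda>w. supp w - X) \<gamma>) p - B X))
      (cells_in supp (\<delta> \<union> \<gamma>)) f
    = overwrite b (cells_in supp \<delta>) f \<inter> B X \<union>
      (overwrite a (cells_in (\<lambda>w. supp w - X) \<gamma>) (shift supp p X f \<delta>) - B X)"
    (is "?l = ?r")
proof (rule set_eqI)
  fix w
  show "w \<in> ?l \<longleftrightarrow> w \<in> ?r"
  proof (cases "w \<in> B X")
    case True
    then have "w \<in> cells_in supp (\<delta> \<union> \<gamma>) \<longleftrightarrow> w \<in> cells_in supp \<delta>"
      using assms by (auto simp: cells_in_def)
    with True show ?thesis
      by (simp add: overwrite_def)
  next
    case False
    have "w \<in> cells_in supp (\<delta> \<union> \<gamma>) \<longleftrightarrow>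
        w \<in> cells_in (\<lambda>w. supp w - X) \<gamma> \<and> supp w \<inter> X \<subseteq> \<delta>"
      using assms False by (auto simp: cells_in_def)
    with False show ?thesis
      by (auto simp: overwrite_def shift_def)
  qed
qed

text \<open>By \<open>inv\<close>, configurations inside \<open>X\<close> are coloured alike
  whichever shift is written on \<gamma>. Hence the old lines extend by \<gamma>, and \<gamma> alone
  is a new line in the colour of the old focus. If that colour already occurs, an old line and its
  focus are monochromatic instead.\<close>

lemma focused_in_extend:
  assumes disj: "\<gamma> \<inter> X = {}" and \<gamma>: "\<gamma> \<noteq> {}" "\<gamma> \<subseteq> Y"
    and inv: "\<And>y f \<delta>. y \<subseteq> cells_in supp X \<Longrightarrow> f \<in> G \<Longrightarrow> \<delta> \<subseteq> X \<Longrightarrow>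
      \<chi> (y \<union> (overwrite a (cells_in (\<lambda>w. supp w - X) \<gamma>) (shift supp p X f \<delta>) - cells_in supp X))
        = \<chi> (y \<union> (z - cells_in supp X))"
    and foc: "focused_in supp p G X (\<lambda>x. \<chi> (x \<inter> cells_in supp X \<union> (z - cells_in supp X))) m"
  shows "monochromatic_in supp p G (X \<union> Y) \<chi> \<or> focused_in supp p G (X \<union> Y) \<chi> (Suc m)"
proof -
  let ?B = "cells_in supp X"
  define \<chi>1 where "\<chi>1 = (\<lambda>x. \<chi> (x \<inter> ?B \<union> (z - ?B)))"
  obtain b C where C: "finite C" "card C = m" and
    lines: "\<And>c. c \<in> C \<Longrightarrow> \<exists>\<delta>. \<delta> \<noteq> {} \<and> \<delta> \<subseteq> X \<and> overwrite b (cells_in supp \<delta>) p = b \<and>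
        (\<forall>f\<in>G. \<chi>1 (overwrite b (cells_in supp \<delta>) f) = c)"
    using foc unfolding focused_in_def \<chi>1_def by blast
  show ?thesis
  proof (cases "\<chi>1 b \<in> C")
    case True
    then have "monochromatic_in supp p G X \<chi>1"
      using lines monochromatic_if_focus_coloured by metis
    then show ?thesis
      unfolding \<chi>1_def using monochromatic_in_restrict by (metis Un_upper1)
  next
    case False
    \<comment> \<open>The new focus keeps \<open>b\<close> inside \<open>X\<close> and carries
      \<open>p\<close> on \<gamma> outside; nothing is claimed about its colour.\<close>
    define b' where "b' = b \<inter> ?B \<union> (overwrite a (cells_in (\<lambda>w. supp w - X) \<gamma>) p - ?B)"
    have line: "\<chi> (overwrite b' (cells_in supp (\<delta> \<union> \<gamma>)) f) = \<chi>1 (overwrite b (cells_in supp \<delta>) f)"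
      if "\<delta> \<subseteq> X" "f \<in> G" for \<delta> f
      unfolding b'_def overwrite_union_shift[OF disj that(1)] \<chi>1_def
      using that by (intro inv) auto
    have base: "overwrite b' (cells_in supp (\<delta> \<union> \<gamma>)) p = b'"
      if "\<delta> \<subseteq> X" "overwrite b (cells_in supp \<delta>) p = b" for \<delta>
    proof -
      have "shift supp p X p \<delta> = p"
        by (auto simp: shift_def)
      then show ?thesis
        unfolding b'_def overwrite_union_shift[OF disj that(1)] that(2) by simp
    qed
    have empty: "overwrite b (cells_in supp {}) f = b" for f
      by (auto simp: overwrite_def cells_in_def)
    have "\<exists>\<delta>. \<delta> \<noteq> {} \<and> \<delta> \<subseteq> X \<union> Y \<and> overwrite b' (cells_in supp \<delta>) p = b' \<and>
        (\<forall>f\<in>G. \<chi> (overwrite b' (cells_in supp \<delta>) f) = c)" if "c \<in> insert (\<chi>1 b) C" for c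
    proof -
      \<comment> \<open>For the new colour \<open>\<chi>1 b\<close> the inner set is empty.\<close>
      have "\<exists>\<delta>\<subseteq>X. overwrite b (cells_in supp \<delta>) p = b \<and>
          (\<forall>f\<in>G. \<chi>1 (overwrite b (cells_in supp \<delta>) f) = c)"
        using that lines empty by (metis insert_iff empty_subsetI)
      then obtain \<delta> where \<delta>: "\<delta> \<subseteq> X" "overwrite b (cells_in supp \<delta>) p = b"
          "\<forall>f\<in>G. \<chi>1 (overwrite b (cells_in supp \<delta>) f) = c"
        by blast
      then show ?thesis
        using \<gamma> line base by (intro exI[of _ "\<delta> \<union> \<gamma>"]) auto
    qed
    then have "focused_in supp p G (X \<union> Y) \<chi> (Suc m)"
      unfolding focused_in_def using C False
      by (intro exI[of _ b'] exI[of _ "insert (\<chi>1 b) C"]) auto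
    then show ?thesis ..
  qed
qed

section \<open>The family seen from outside a finite set\<close>

text \<open>Colours are natural numbers, so a whole colouring of \<open>Pow B\<close> has to be
  coded before it can serve as a colour.\<close>

lemma finite_colouring_code:
  fixes B :: "'w set" and r :: nat
  assumes "finite B"
  shows "\<exists>(enc :: ('w set \<Rightarrow> nat) \<Rightarrow> nat) r'.
    (\<forall>h\<in>Pow B \<rightarrow>\<^sub>E {..<r}. enc h < r') \<and> inj_on enc (Pow B \<rightarrow>\<^sub>E {..<r})"
proof -
  have "finite (Pow B \<rightarrow>\<^sub>E {..<r})"
    using assms by (intro finite_PiE) auto
  then obtain n and enc :: "('w set \<Rightarrow> nat) \<Rightarrow> nat"
    where "enc ` (Pow B \<rightarrow>\<^sub>E {..<r}) = {i. i < n}" "inj_on enc (Pow B \<rightarrow>\<^sub>E {..<r})"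
    using finite_imp_inj_to_nat_seg by metis
  then show ?thesis
    by (intro exI[of _ enc] exI[of _ n]) auto
qed

text \<open>Shifts of members of \<open>F\<close> may still differ from one another on supports of
  size \<open>e - 1\<close>, so each forms a class of its own with that label. All other classes
  keep their labels.\<close>

definition outer_family ::
    "('w \<Rightarrow> 'u set) \<Rightarrow> 'w set \<Rightarrow> 'u set \<Rightarrow> nat \<Rightarrow> 'w set set \<Rightarrow> (nat \<times> 'w set set) multiset \<Rightarrow>
      (nat \<times> 'w set set) multiset" where
  "outer_family supp p X e F L =
    image_mset (\<lambda>(e', F'). (e', (\<lambda>(f, \<delta>). shift supp p X f \<delta>) ` (F' \<times> Pow X))) L +
    image_mset (\<lambda>g. (e - 1, {g})) (mset_set ((\<lambda>(f, \<delta>). shift supp p X f \<delta>) ` (F \<times> Pow X)))"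

lemma shift_in_members_outer_family:
  assumes "f \<in> F \<union> members L" "\<delta> \<subseteq> X" "finite F" "finite X"
  shows "shift supp p X f \<delta> \<in> members (outer_family supp p X e F L)"
proof -
  have "finite ((\<lambda>(f, \<delta>). shift supp p X f \<delta>) ` (F \<times> Pow X))"
    using assms by auto
  then show ?thesis
    using assms unfolding members_def outer_family_def by fastforce
qed

text \<open>One copy of \<open>e\<close> is traded for finitely many copies of \<open>e - 1\<close>,
  however many subsets \<delta> there are.\<close>

lemma weight_outer_family:
  assumes "e > 0" "finite F" "finite X"
  shows "(image_mset fst (outer_family supp p X e F L), image_mset fst (add_mset (e, F) L))
    \<in> mult less_than"
proof -
  let ?S = "(\<lambda>(f, \<delta>). shift supp p X f \<delta>) ` (F \<times> Pow X)"
  have "(image_mset fst L + image_mset (\<lambda>_. e - 1) (mset_set ?S), image_mset fst L + {#e#})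
      \<in> mult less_than"
    using assms by (intro one_step_implies_mult) auto
  then show ?thesis
    by (simp add: outer_family_def image_mset.compositionality comp_def case_prod_unfold)
qed

text \<open>Since \<open>e\<close> is least, \<open>f1\<close> agrees with \<open>p\<close> on all
  supports larger than any other label \<open>e'\<close>, so making it the base raises no
  label.\<close>

lemma graded_family_outer_family:
  assumes fin: "\<And>w. finite (supp w)" and "finite X" and e: "e > 0"
    and fam: "graded_family supp p (add_mset (e, F) L)"
    and least: "\<And>e' F'. (e', F') \<in># L \<Longrightarrow> e \<le> e'" and f1: "f1 \<in> F"
  shows "graded_family (\<lambda>w. supp w - X) (shift supp p X f1 {}) (outer_family supp p X e F L)"
proof -
  let ?sh = "shift supp p X"
  let ?s = "\<lambda>w. supp w - X"
  let ?p' = "?sh f1 {}"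
  have F: "finite F" "\<And>f. f \<in> F \<Longrightarrow> agree_from supp (Suc e) p f"
      "\<And>f g. f \<in> F \<Longrightarrow> g \<in> F \<Longrightarrow> agree_from supp e f g"
    using fam by (auto simp: graded_family_def)
  have L: "finite F'" "\<And>f. f \<in> F' \<Longrightarrow> agree_from supp (Suc e') p f"
      "\<And>f g. f \<in> F' \<Longrightarrow> g \<in> F' \<Longrightarrow> agree_from supp e' f g" if "(e', F') \<in># L" for e' F'
    using fam that by (auto simp: graded_family_def)
  have old: "finite ((\<lambda>(f, \<delta>). ?sh f \<delta>) ` (F' \<times> Pow X))"
      "\<And>f \<delta>. f \<in> F' \<Longrightarrow> agree_from (\<lambda>w. supp w - X) (Suc e') (?sh f1 {}) (?sh f \<delta>)"
      "\<And>f \<delta> g \<epsilon>. f \<in> F' \<Longrightarrow> g \<in> F' \<Longrightarrow> agree_from (\<lambda>w. supp w - X) e' (?sh f \<delta>) (?sh g \<epsilon>)"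
    if "(e', F') \<in># L" for e' F'
  proof -
    show "finite ((\<lambda>(f, \<delta>). ?sh f \<delta>) ` (F' \<times> Pow X))"
      using L(1)[OF that] \<open>finite X\<close> by auto
    have "agree_from supp (Suc e') p f1"
      using F(2)[OF f1] least[OF that] by (auto intro: agree_from_mono)
    then show "agree_from (\<lambda>w. supp w - X) (Suc e') (?sh f1 {}) (?sh f \<delta>)" if "f \<in> F'" for f \<delta>
      using L(2)[OF \<open>(e', F') \<in># L\<close> that] by (intro agree_from_shift_base fin)
    show "agree_from (\<lambda>w. supp w - X) e' (?sh f \<delta>) (?sh g \<epsilon>)" if "f \<in> F'" "g \<in> F'" for f \<delta> g \<epsilon>
      using L(2,3)[OF \<open>(e', F') \<in># L\<close>] that by (intro agree_from_shift fin) auto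
  qed
  \<comment> \<open>\<open>f1\<close> and \<open>f\<close> lie in one class, so their shifts agree
    from \<open>e\<close>, which is \<open>Suc (e - 1)\<close>.\<close>
  have new: "agree_from (\<lambda>w. supp w - X) e (?sh f1 {}) (?sh f \<delta>)" if "f \<in> F" for f \<delta>
    using F(2,3) f1 that by (intro agree_from_shift fin) auto
  have "finite ((\<lambda>(f, \<delta>). ?sh f \<delta>) ` (F \<times> Pow X))"
    using F(1) \<open>finite X\<close> by auto
  moreover have "finite F'' \<and> (\<forall>f\<in>F''. agree_from ?s (Suc e'') ?p' f \<and>
      (\<forall>g\<in>F''. agree_from ?s e'' f g))"
    if "e'' = e'" "F'' = (\<lambda>(f, \<delta>). ?sh f \<delta>) ` (F' \<times> Pow X)" "(e', F') \<in># L" for e' F' e'' F''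
    using old[OF that(3)] that(1,2) by auto
  moreover have "finite F'' \<and> (\<forall>f\<in>F''. agree_from ?s (Suc e'') ?p' f \<and>
      (\<forall>g\<in>F''. agree_from ?s e'' f g))"
    if "e'' = e - 1" "F'' = {?sh f \<delta>}" "f \<in> F" for e'' F'' f \<delta>
    using new[OF that(3)] that(1,2) e by (simp add: agree_from_def)
  ultimately show ?thesis
    unfolding graded_family_def outer_family_def by auto
qed

section \<open>The colour focusing induction\<close>

text \<open>The hypothesis \<open>IH\<close> ranges over supports, ground sets and numbers of
  colours because all three change: \<open>X\<close> is removed from the first two, and the colours
  become colourings of the configurations inside \<open>X\<close>.\<close>

lemma focusing:
  fixes supp :: "'w \<Rightarrow> 'u set"
  assumes lf: "locally_finite supp" and U: "infinite U"
    and fam: "graded_family supp p (add_mset (e, F) L)" and e: "e > 0" and f1: "f1 \<in> F"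
    and least: "\<And>e' F'. (e', F') \<in># L \<Longrightarrow> e \<le> e'"
    and IH: "\<And>(supp' :: 'w \<Rightarrow> 'u set) U' p' L' r'.
      (image_mset fst L', image_mset fst (add_mset (e, F) L)) \<in> mult less_than \<Longrightarrow>
      locally_finite supp' \<Longrightarrow> infinite U' \<Longrightarrow> graded_family supp' p' L' \<Longrightarrow>
      \<exists>X. finite X \<and> X \<subseteq> U' \<and>
        (\<forall>\<chi>. (\<forall>x. \<chi> x < r') \<longrightarrow> monochromatic_in supp' p' (members L') X \<chi>)"
  shows "\<exists>X. finite X \<and> X \<subseteq> U \<and> (\<forall>\<chi>. (\<forall>x. \<chi> x < r) \<longrightarrow>
    monochromatic_in supp p (F \<union> members L) X \<chi> \<or> focused_in supp p (F \<union> members L) X \<chi> m)"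
proof (induction m)
  case 0
  show ?case
    by (intro exI[of _ "{}"]) (auto simp: focused_in_def)
next
  case (Suc m)
  let ?G = "F \<union> members L"
  obtain X where X: "finite X" "X \<subseteq> U" and foc: "\<And>\<chi>. (\<forall>x. \<chi> x < r) \<Longrightarrow>
      monochromatic_in supp p ?G X \<chi> \<or> focused_in supp p ?G X \<chi> m"
    using Suc by blast
  let ?B = "cells_in supp X"
  let ?s = "\<lambda>w. supp w - X"
  let ?p' = "shift supp p X f1 {}"
  let ?L' = "outer_family supp p X e F L"
  have fin: "\<And>w. finite (supp w)" and B: "finite ?B"
    using lf X by (auto simp: locally_finite_def)
  have F: "finite F"
    using fam by (auto simp: graded_family_def)
  obtain enc :: "('w set \<Rightarrow> nat) \<Rightarrow> nat" and r' where
    enc: "\<And>h. h \<in> Pow ?B \<rightarrow>\<^sub>E {..<r} \<Longrightarrow> enc h < r'" "inj_on enc (Pow ?B \<rightarrow>\<^sub>E {..<r})"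
    using finite_colouring_code[OF B, of r] by metis
  \<comment> \<open>Searching in \<open>U - X\<close> keeps the new set \<gamma> disjoint from
    \<open>X\<close>.\<close>
  have "\<exists>Y. finite Y \<and> Y \<subseteq> U - X \<and>
      (\<forall>\<chi>. (\<forall>x. \<chi> x < r') \<longrightarrow> monochromatic_in ?s ?p' (members ?L') Y \<chi>)"
    using weight_outer_family[OF e F X(1)] locally_finite_diff[OF lf X(1)] U X
      graded_family_outer_family[OF fin X(1) e fam least f1]
    by (intro IH) auto
  then obtain Y where Y: "finite Y" "Y \<subseteq> U - X" and
    mono: "\<And>\<chi>. (\<forall>x. \<chi> x < r') \<Longrightarrow> monochromatic_in ?s ?p' (members ?L') Y \<chi>"
    by blast
  have "monochromatic_in supp p ?G (X \<union> Y) \<chi> \<or> focused_in supp p ?G (X \<union> Y) \<chi> (Suc m)"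
    if \<chi>: "\<forall>x. \<chi> x < r" for \<chi>
  proof -
    \<comment> \<open>The restriction to \<open>Pow ?B\<close> puts the induced colouring into the
      extensional function space on which \<open>enc\<close> is injective.\<close>
    define induced where "induced x = (\<lambda>y\<in>Pow ?B. \<chi> (y \<union> (x - ?B)))" for x
    have ind: "induced x \<in> Pow ?B \<rightarrow>\<^sub>E {..<r}" for x
      using \<chi> by (auto simp: induced_def)
    then have "\<forall>x. enc (induced x) < r'"
      using enc(1) by blast
    then obtain a \<gamma> where \<gamma>: "\<gamma> \<noteq> {}" "\<gamma> \<subseteq> Y" and
      a: "\<And>g. g \<in> members ?L' \<Longrightarrow> enc (induced (overwrite a (cells_in ?s \<gamma>) g))
        = enc (induced (overwrite a (cells_in ?s \<gamma>) ?p'))"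
      using mono[of "\<lambda>x. enc (induced x)"] unfolding monochromatic_in_def by blast
    let ?z = "overwrite a (cells_in ?s \<gamma>) ?p'"
    have inv: "\<chi> (y \<union> (overwrite a (cells_in ?s \<gamma>) (shift supp p X f \<delta>) - ?B))
        = \<chi> (y \<union> (?z - ?B))"
      if "y \<subseteq> ?B" "f \<in> ?G" "\<delta> \<subseteq> X" for y f \<delta>
    proof -
      have "induced (overwrite a (cells_in ?s \<gamma>) (shift supp p X f \<delta>)) = induced ?z"
        using a[OF shift_in_members_outer_family[OF that(2,3) F X(1)]]
        by (rule inj_onD[OF enc(2) _ ind ind])
      then have "induced (overwrite a (cells_in ?s \<gamma>) (shift supp p X f \<delta>)) y = induced ?z y"
        by simp
      then show ?thesis
        using that(1) by (simp add: induced_def)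
    qed
    have "\<gamma> \<inter> X = {}"
      using \<gamma> Y by blast
    note ext = focused_in_extend[of \<gamma> X Y supp ?G \<chi> a p ?z m, OF this \<gamma> inv]
    from foc[of "\<lambda>x. \<chi> (x \<inter> ?B \<union> (?z - ?B))"] \<chi> show ?thesis
      using ext monochromatic_in_restrict[of supp p ?G X \<chi> ?z "X \<union> Y"] by auto
  qed
  then show ?case
    using X Y by (intro exI[of _ "X \<union> Y"]) auto
qed

text \<open>Pigeonhole: through \<open>f\<close>, each of the \<open>Suc r\<close> colours in
  \<open>C\<close> is a value of \<chi>.\<close>

lemma not_focused_in:
  assumes "\<forall>x. \<chi> x < r" and "f \<in> G"
  shows "\<not> focused_in supp p G X \<chi> (Suc r)"
proof
  assume "focused_in supp p G X \<chi> (Suc r)"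
  then obtain b C where C: "card C = Suc r" and
    lines: "\<And>c. c \<in> C \<Longrightarrow> \<exists>\<delta>. \<chi> (overwrite b (cells_in supp \<delta>) f) = c"
    using assms(2) unfolding focused_in_def by blast
  have "C \<subseteq> {..<r}"
    using lines assms(1) by blast
  then have "card C \<le> r"
    using card_mono[of "{..<r}" C] by simp
  with C show False by simp
qed

section \<open>Induction on the weight\<close>

theorem polynomial_Hales_Jewett:
  fixes supp :: "'w \<Rightarrow> 'u set"
  assumes "locally_finite supp" and "infinite U" and "graded_family supp p L"
  shows "\<exists>X. finite X \<and> X \<subseteq> U \<and>
    (\<forall>\<chi>. (\<forall>x. \<chi> x < r) \<longrightarrow> monochromatic_in supp p (members L) X \<chi>)"
  using assms
proof (induction "image_mset fst L" arbitrary: supp U p L r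
    rule: wf_induct_rule[OF wf_mult[OF wf_less_than]])
  case (1 L supp U p r)
  have IH: "\<exists>X. finite X \<and> X \<subseteq> U' \<and>
      (\<forall>\<chi>. (\<forall>x. \<chi> x < r') \<longrightarrow> monochromatic_in supp' p' (members L') X \<chi>)"
    if "(image_mset fst L', image_mset fst L) \<in> mult less_than"
      "locally_finite supp'" "infinite U'" "graded_family supp' p' L'"
    for supp' :: "'w \<Rightarrow> 'u set" and U' p' L' r'
    using that by (intro "1.hyps") auto
  show ?case
  proof (cases "L = {#}")
    case True
    obtain u where "u \<in> U"
      using \<open>infinite U\<close> by (metis finite.emptyI ex_in_conv)
    then show ?thesis
      using True by (intro exI[of _ "{u}"]) (auto simp: monochromatic_in_def members_def)
  next
    case False
    define e where "e = Min (fst ` set_mset L)"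
    have "e \<in> fst ` set_mset L"
      unfolding e_def using False by (intro Min_in) auto
    then obtain F L0 where L: "L = add_mset (e, F) L0"
      by (metis imageE multi_member_split prod.collapse)
    have least: "e \<le> e'" if "(e', F') \<in># L0" for e' F'
      unfolding e_def using that L by (intro Min_le) force+
    have fam0: "graded_family supp p L0"
      using "1.prems" L by (auto simp: graded_family_def)
    have fin: "finite (supp w)" for w
      using "1.prems" by (simp add: locally_finite_def)
    show ?thesis
    proof (cases "e = 0 \<or> F = {}")
      \<comment> \<open>Overwriting cannot tell members of a class labelled 0 from \<open>p\<close>.
        Such a class, or an empty one, is dropped, which lowers the weight.\<close>
      case True
      have "(image_mset fst L0, image_mset fst L) \<in> mult less_than"
        using one_step_implies_mult[of "{#e#}" "{#}" less_than "image_mset fst L0"] L by simp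
      then obtain X where X: "finite X" "X \<subseteq> U" and
        mono: "\<And>\<chi>. (\<forall>x. \<chi> x < r) \<Longrightarrow> monochromatic_in supp p (members L0) X \<chi>"
        using IH[OF _ \<open>locally_finite supp\<close> \<open>infinite U\<close> fam0] by metis
      have "overwrite a (cells_in supp \<gamma>) f = overwrite a (cells_in supp \<gamma>) p" if "f \<in> F" for a \<gamma> f
        using True that \<open>graded_family supp p L\<close> L
        by (intro overwrite_agree_from_one fin) (auto simp: graded_family_def)
      then have "monochromatic_in supp p (members L) X \<chi>" if "\<forall>x. \<chi> x < r" for \<chi>
        using mono[OF that] unfolding monochromatic_in_def L by (metis UnE members_add_mset)
      then show ?thesis
        using X by blast
    next
      case False
      then obtain f1 where f1: "f1 \<in> F" and "e > 0" by auto
      \<comment> \<open>Asking for \<open>Suc r\<close> focused colours leaves only the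
        monochromatic alternative.\<close>
      have "\<exists>X. finite X \<and> X \<subseteq> U \<and> (\<forall>\<chi>. (\<forall>x. \<chi> x < r) \<longrightarrow>
          monochromatic_in supp p (F \<union> members L0) X \<chi> \<or>
          focused_in supp p (F \<union> members L0) X \<chi> (Suc r))"
        using "1.prems" IH least \<open>e > 0\<close> f1 unfolding L by (intro focusing) auto
      moreover have "\<not> focused_in supp p (F \<union> members L0) X \<chi> (Suc r)" if "\<forall>x. \<chi> x < r" for X \<chi>
        using f1 that by (intro not_focused_in) auto
      ultimately show ?thesis
        unfolding L members_add_mset by metis
    qed
  qed
qed

section \<open>Application to Cartesian powers\<close>

theorem mainTheorem1:
  fixes r d q :: nat
  assumes "r \<ge> 1" and "d \<ge> 1" and "q \<ge> 1"
  shows "\<exists>N::nat. N \<ge> 1 \<and>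
    (let V = cart_power {1..N} d \<times> {1..q} in
      \<forall>\<chi> :: ((nat \<Rightarrow> nat) \<times> nat) set \<Rightarrow> nat. r_coloring r (Pow V) \<chi> \<longrightarrow>
        (\<exists>a \<gamma>. a \<subseteq> V \<and> \<gamma> \<noteq> {} \<and> \<gamma> \<subseteq> {1..N} \<and>
          a \<inter> (cart_power \<gamma> d \<times> {1..q}) = {} \<and>
          (\<forall>i\<in>{1..q}. \<chi> (a \<union> (cart_power \<gamma> d \<times> {i})) = \<chi> a)))"
proof -
  \<comment> \<open>Pairs that are not cells get empty support and are therefore never
    overwritten.\<close>
  define supp :: "(nat \<Rightarrow> nat) \<times> nat \<Rightarrow> nat set" where
    "supp w = (if w \<in> cart_power UNIV d \<times> {1..q} then fst w ` {1..d} else {})" for w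
  \<comment> \<open>With base \<open>{}\<close>, writing the base empties the cells over \<gamma>,
    and writing \<open>UNIV \<times> {i}\<close> leaves exactly the layer \<open>i\<close>. The
    label \<open>d\<close> is valid because a tuple has at most \<open>d\<close> entries.\<close>
  define L :: "(nat \<times> ((nat \<Rightarrow> nat) \<times> nat) set set) multiset" where
    "L = image_mset (\<lambda>i. (d, {UNIV \<times> {i}})) (mset_set {1..q})"
  have cells: "cells_in supp X = cart_power X d \<times> {1..q}" for X
    using assms(2) by (auto simp: cells_in_def supp_def cart_power_def PiE_iff split: if_splits)
  have fin: "finite (supp w)" for w
    by (simp add: supp_def)
  have "finite (cart_power X d)" if "finite X" for X :: "nat set"
    unfolding cart_power_def using that by (intro finite_PiE) auto
  then have lf: "locally_finite supp"
    using fin by (simp add: locally_finite_def cells)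
  have "card (supp w) \<le> d" for w
    using card_image_le[of "{1..d}" "fst w"] by (simp add: supp_def)
  then have fam: "graded_family supp {} L"
    by (auto simp: graded_family_def L_def agree_from_def not_less_eq_eq[symmetric])
  have "infinite {1::nat..}"
    by (simp add: infinite_Ici)
  \<comment> \<open>The colours \<open>1..r\<close> are values below \<open>Suc r\<close>.\<close>
  from polynomial_Hales_Jewett[OF lf this fam, of "Suc r"]
  obtain X where X: "finite X" "X \<subseteq> {1..}" and
    mono: "\<And>\<chi>. (\<forall>x. \<chi> x < Suc r) \<Longrightarrow> monochromatic_in supp {} (members L) X \<chi>"
    by blast
  define N where "N = Max (insert 1 X)"
  have N: "N \<ge> 1" "X \<subseteq> {1..N}"
    using X by (auto simp: N_def)
  define V where "V = cart_power {1..N} d \<times> {1..q}"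
  have "\<exists>a \<gamma>. a \<subseteq> V \<and> \<gamma> \<noteq> {} \<and> \<gamma> \<subseteq> {1..N} \<and> a \<inter> (cart_power \<gamma> d \<times> {1..q}) = {} \<and>
      (\<forall>i\<in>{1..q}. \<chi> (a \<union> (cart_power \<gamma> d \<times> {i})) = \<chi> a)"
    if \<chi>: "r_coloring r (Pow V) \<chi>" for \<chi>
  proof -
    \<comment> \<open>Intersecting with \<open>V\<close> extends the colouring to all
      configurations.\<close>
    have "\<chi> (x \<inter> V) < Suc r" for x
      using \<chi> by (simp add: r_coloring_def Pi_iff less_Suc_eq_le)
    then obtain a \<gamma> where \<gamma>: "\<gamma> \<noteq> {}" "\<gamma> \<subseteq> X" and
      a: "\<forall>f\<in>members L. \<chi> (overwrite a (cells_in supp \<gamma>) f \<inter> V)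
        = \<chi> (overwrite a (cells_in supp \<gamma>) {} \<inter> V)"
      using mono[of "\<lambda>x. \<chi> (x \<inter> V)"] unfolding monochromatic_in_def by blast
    define a' where "a' = (a - cart_power \<gamma> d \<times> {1..q}) \<inter> V"
    have "cart_power \<gamma> d \<subseteq> cart_power {1..N} d"
      unfolding cart_power_def using \<gamma> N by (intro PiE_mono) auto
    then have "overwrite a (cells_in supp \<gamma>) (UNIV \<times> {i}) \<inter> V = a' \<union> cart_power \<gamma> d \<times> {i}"
      if "i \<in> {1..q}" for i
      using that by (auto simp: overwrite_def cells a'_def V_def)
    moreover have "overwrite a (cells_in supp \<gamma>) {} \<inter> V = a'"
      by (simp add: overwrite_def cells a'_def)
    moreover have "UNIV \<times> {i} \<in> members L" if "i \<in> {1..q}" for i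
      using that by (auto simp: members_def L_def)
    ultimately have "\<forall>i\<in>{1..q}. \<chi> (a' \<union> cart_power \<gamma> d \<times> {i}) = \<chi> a'"
      using a by metis
    then show ?thesis
      using \<gamma> N by (intro exI[of _ a'] exI[of _ \<gamma>]) (auto simp: a'_def)
  qed
  then show ?thesis
    using N(1) unfolding V_def Let_def by blast
qed

end
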